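(* There is a function $f$ on the positive integers with $f(d) \to 0$ as $d \to \infty$ such that, for the range family $\mathcal{R}_{\text{ST}}$ of all axis-aligned strips in $\mathbb{R}^d$ and every integer $k \geq 2$, we have $$m_{\mathcal{R}_{\text{ST}}}(k) \;\leq\; 3\mathrm{e}\, d\,(1+f(d)) \cdot k .$$
   Context: The family of all axis-aligned strips in $\mathbb{R}^d$ is $\mathcal{R}_{\text{ST}} = \mathcal{R}_{\text{ST}}^1 \cup \cdots \cup \mathcal{R}_{\text{ST}}^d$ with $\mathcal{R}_{\text{ST}}^i = \{ \{(x_1,\ldots,x_d) \in \mathbb{R}^d \mid a \leq x_i \leq b\} \mid a,b \in \mathbb{R}\}$. For a range family $\mathcal{R}$ (a family of subsets of $\mathbb{R}^d$), a finite point set $V \subset \mathbb{R}^d$ and a positive integer $m$, $\mathcal{H}(V,\mathcal{R},m)$ is the hypergraph with vertex set $V$ whose hyperedges are exactly the subsets $e \subseteq V$ with $|e| = m$ for which there is some $R \in \mathcal{R}$ with $e = V \cap R$. A polychromatic $k$-coloring of a hypergraph is a map from its vertices to $\{1,\ldots,k\}$ such that every hyperedge contains vertices of all $k$ colors. The quantity $m_{\mathcal{R}}(k)$ is the smallest positive integer $m$ (or $\infty$ if none exists) such that for every finite $V \subset \mathbb{R}^d$ in general position (distinct points of $V$ have pairwise different $i$-th coordinates for every $i$) the hypergraph $\mathcal{H}(V,\mathcal{R},m)$ has a polychromatic $k$-coloring. Here $\mathrm{e} = 2.71828\ldots$ is Euler's number, and $f$ depends only on $d$. *)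

theory Defs
  imports Complex_Main "HOL-Library.FuncSet" "HOL-Library.Extended_Real"
begin

(* The dimension d varies inside the main statement, so it cannot be a type: points of R^d are
   the extensional functions on the index set {1..d}. *)
definition Rn :: "nat \<Rightarrow> (nat \<Rightarrow> real) set" where
  "Rn d = {1..d} \<rightarrow>\<^sub>E UNIV"

definition strips_dir :: "nat \<Rightarrow> nat \<Rightarrow> (nat \<Rightarrow> real) set set" where
  "strips_dir d i = {{x \<in> Rn d. a \<le> x i \<and> x i \<le> b} | a b. True}"

definition strips :: "nat \<Rightarrow> (nat \<Rightarrow> real) set set" where
  "strips d = (\<Union>i\<in>{1..d}. strips_dir d i)"

(* A hypergraph is a pair of a vertex set and a set of hyperedges. *)
type_synonym 'a hypergraph = "'a set \<times> 'a set set"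

definition range_hypergraph :: "'a set \<Rightarrow> 'a set set \<Rightarrow> nat \<Rightarrow> 'a hypergraph" where
  "range_hypergraph V \<R> m = (V, {e. e \<subseteq> V \<and> card e = m \<and> (\<exists>R\<in>\<R>. e = V \<inter> R)})"

definition polychromatic_coloring :: "nat \<Rightarrow> 'a hypergraph \<Rightarrow> ('a \<Rightarrow> nat) \<Rightarrow> bool" where
  "polychromatic_coloring k H c \<longleftrightarrow>
     c \<in> fst H \<rightarrow> {1..k} \<and> (\<forall>e\<in>snd H. \<forall>j\<in>{1..k}. \<exists>v\<in>e. c v = j)"

definition general_position :: "nat \<Rightarrow> (nat \<Rightarrow> real) set \<Rightarrow> bool" where
  "general_position d V \<longleftrightarrow> (\<forall>x\<in>V. \<forall>y\<in>V. x \<noteq> y \<longrightarrow> (\<forall>i\<in>{1..d}. x i \<noteq> y i))"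

definition always_polychromatic ::
  "nat \<Rightarrow> (nat \<Rightarrow> real) set set \<Rightarrow> nat \<Rightarrow> nat \<Rightarrow> bool" where
  "always_polychromatic d \<R> k m \<longleftrightarrow>
     (\<forall>V. V \<subseteq> Rn d \<and> finite V \<and> general_position d V \<longrightarrow>
        (\<exists>c. polychromatic_coloring k (range_hypergraph V \<R> m) c))"

(* The infimum of the empty set in the extended naturals is infinity. *)
definition poly_number :: "nat \<Rightarrow> (nat \<Rightarrow> real) set set \<Rightarrow> nat \<Rightarrow> enat" where
  "poly_number d \<R> k = Inf {enat m | m. m > 0 \<and> always_polychromatic d \<R> k m}"

end

theory Submission
  imports Defs
begin

text \<open>
  The theorem holds with \<open>f = 0\<close>, because \<open>m = 4dk\<close> always suffices and \<open>4 \<le> 3e\<close>.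

  Along each coordinate axis, cut the sorted points into consecutive blocks of \<open>s = 2dk\<close> points.
  A strip with \<open>2s\<close> points contains a full block of its own direction, so it is enough to color the
  points in such a way that every full block sees all \<open>k\<close> colors. A point lies in at most one
  block per direction, hence in at most \<open>d\<close> blocks, and a set system of maximum degree \<open>d\<close> has
  a coloring in which the color classes split every set \<open>B\<close> almost evenly: each class meets \<open>B\<close>
  in \<open>card B / k\<close> points up to an error smaller than \<open>2d\<close> (\<open>multicolor_Beck_Fiala\<close>). For
  \<open>card B \<ge> 2dk\<close> no class can miss \<open>B\<close>.

  The coloring comes from rounding the fractional coloring that gives every point a share of
  \<open>1/k\<close> of each color. The rounding is the linear-algebra argument of Beck and Fiala
  (\<open>weighted_Beck_Fiala_rounding\<close>): keep only those sum constraints that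
  still contain many fractional variables. As long as these are fewer than the fractional variables,
  there is a direction that preserves all of them, and moving along it makes one more variable
  integral. A constraint that has been dropped contains few fractional variables, so it cannot be
  spoiled by much. Each constraint \<open>j\<close> has its own threshold \<open>T j\<close> here: the constraint
  that a point receives exactly one color has threshold \<open>1\<close>, which leaves no error at all
  between integers, and the constraints that balance the colors in the blocks have threshold \<open>2d\<close>.
\<close>

section \<open>Rounding fractional vectors\<close>

lemma underdetermined_system_nontrivial_solution:
  fixes a :: "'j \<Rightarrow> 'u \<Rightarrow> 'f::field"
  assumes "finite J" "finite F" "card J < card F"
  shows "\<exists>w. (\<exists>u\<in>F. w u \<noteq> 0) \<and> (\<forall>j\<in>J. (\<Sum>u\<in>F. a j u * w u) = 0)"
  using assms
proof (induction J arbitrary: F a rule: finite_induct)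
  case empty
  then have "F \<noteq> {}" by auto
  then show ?case by (intro exI[of _ "\<lambda>_. 1"]) auto
next
  case (insert j J)
  show ?case
  proof (cases "\<forall>u\<in>F. a j u = 0")
    case True
    have "card J < card F" using insert by simp
    then obtain w where "\<exists>u\<in>F. w u \<noteq> 0" "\<forall>i\<in>J. (\<Sum>u\<in>F. a i u * w u) = 0"
      using insert.IH insert.prems by blast
    with True show ?thesis by (intro exI[of _ w]) auto
  next
    case False
    then obtain p where p: "p \<in> F" "a j p \<noteq> 0" by blast
    define G where "G = F - {p}"
    have F: "F = insert p G" "p \<notin> G" "finite G"
      using p insert.prems by (auto simp: G_def)
    have "card J < card G" using insert F by simp
    then obtain w where w: "\<exists>u\<in>G. w u \<noteq> 0"
      "\<forall>i\<in>J. (\<Sum>u\<in>G. (a i u - a i p / a j p * a j u) * w u) = 0"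
      using insert.IH[of G "\<lambda>i u. a i u - a i p / a j p * a j u"] F(3) by blast
    define s where "s = (\<Sum>u\<in>G. a j u * w u)"
    \<comment> \<open>The value at the pivot is the one that solves equation \<open>j\<close>.\<close>
    define w' where "w' = w(p := - s / a j p)"
    have sum_w': "(\<Sum>u\<in>F. a i u * w' u) = a i p * (- s / a j p) + (\<Sum>u\<in>G. a i u * w u)" for i
    proof -
      have "(\<Sum>u\<in>G. a i u * w' u) = (\<Sum>u\<in>G. a i u * w u)"
        using F(2) by (intro sum.cong) (auto simp: w'_def)
      then show ?thesis using F by (simp add: w'_def)
    qed
    have "(\<Sum>u\<in>F. a i u * w' u) = 0" if "i \<in> insert j J" for i
    proof (cases "i = j")
      case True
      then show ?thesis using p by (simp add: sum_w' s_def)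
    next
      case False
      with that have "(\<Sum>u\<in>G. (a i u - a i p / a j p * a j u) * w u) = 0"
        using w by auto
      moreover have "(\<Sum>u\<in>G. (a i u - a i p / a j p * a j u) * w u)
          = (\<Sum>u\<in>G. a i u * w u) - a i p / a j p * s"
        by (simp add: s_def algebra_simps sum_subtractf sum_distrib_left)
      ultimately show ?thesis by (simp add: sum_w')
    qed
    moreover have "\<exists>u\<in>F. w' u \<noteq> 0" using w(1) F by (auto simp: w'_def)
    ultimately show ?thesis by blast
  qed
qed

text \<open>
  The step length is the smallest one at which some coordinate that actually moves reaches an
  endpoint of the unit interval in its direction of motion.
\<close>

lemma move_to_cube_boundary:
  fixes x w :: "'u \<Rightarrow> real"
  assumes "finite F" and x: "\<And>u. u \<in> F \<Longrightarrow> 0 < x u \<and> x u < 1"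
    and w: "\<exists>u\<in>F. w u \<noteq> 0"
  obtains t where "\<And>u. u \<in> F \<Longrightarrow> 0 \<le> x u + t * w u \<and> x u + t * w u \<le> 1"
    and "\<exists>u\<in>F. x u + t * w u \<in> {0, 1}"
proof -
  define G where "G = {u \<in> F. w u \<noteq> 0}"
  define h where "h u = (if w u > 0 then (1 - x u) / w u else - x u / w u)" for u
  have G: "finite G" "G \<noteq> {}" using assms by (auto simp: G_def)
  define t where "t = Min (h ` G)"
  have "t \<in> h ` G" unfolding t_def using G by (intro Min_in) auto
  then obtain p where p: "p \<in> G" "t = h p" by blast
  have le: "t \<le> h u" if "u \<in> G" for u unfolding t_def using G that by auto
  have "0 \<le> h u" if "u \<in> G" for u
    using that x[of u] by (auto simp: h_def G_def divide_simps)
  then have t0: "0 \<le> t" using p by auto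
  show ?thesis
  proof
    fix u assume u: "u \<in> F"
    consider "w u = 0" | "w u > 0" | "w u < 0" by linarith
    then show "0 \<le> x u + t * w u \<and> x u + t * w u \<le> 1"
    proof cases
      case 1 then show ?thesis using x[OF u] by simp
    next
      case 2
      then have "t \<le> (1 - x u) / w u" using le[of u] u by (auto simp: h_def G_def)
      then have "t * w u \<le> 1 - x u" using 2 by (simp add: field_simps)
      moreover have "0 \<le> t * w u" using t0 2 by simp
      ultimately show ?thesis using x[OF u] by simp
    next
      case 3
      then have "t \<le> - x u / w u" using le[of u] u by (auto simp: h_def G_def)
      then have "- x u \<le> t * w u" using 3 by (simp add: field_simps)
      moreover have "t * w u \<le> 0" using t0 3 by (simp add: mult_nonneg_nonpos)
      ultimately show ?thesis using x[OF u] by simp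
    qed
  next
    have "x p + t * w p \<in> {0, 1}" using p by (auto simp: h_def G_def)
    then show "\<exists>u\<in>F. x u + t * w u \<in> {0, 1}" using p by (auto simp: G_def)
  qed
qed

text \<open>
  Double counting: every constraint with more than \<open>T j\<close> variables in \<open>F\<close> receives a total of at
  least \<open>1\<close> when each of its variables pays it \<open>1 / (T j + 1)\<close>, and no variable pays \<open>1\<close> or more
  altogether.
\<close>

lemma card_active_constraints_less:
  fixes A :: "'j \<Rightarrow> 'u set" and T :: "'j \<Rightarrow> nat"
  assumes "finite J" "finite F" "F \<noteq> {}"
    and load: "\<And>u. u \<in> F \<Longrightarrow> (\<Sum>j | j \<in> J \<and> u \<in> A j. 1 / (real (T j) + 1)) < 1"
  shows "card {j \<in> J. card (F \<inter> A j) > T j} < card F"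
proof -
  let ?c = "\<lambda>j. 1 / (real (T j) + 1)"
  have "real (card {j \<in> J. card (F \<inter> A j) > T j})
      = (\<Sum>j | j \<in> J \<and> card (F \<inter> A j) > T j. 1)" by simp
  also have "\<dots> \<le> (\<Sum>j | j \<in> J \<and> card (F \<inter> A j) > T j. real (card (F \<inter> A j)) * ?c j)"
    by (rule sum_mono) (auto simp: divide_simps)
  also have "\<dots> \<le> (\<Sum>j\<in>J. real (card (F \<inter> A j)) * ?c j)"
    using assms by (intro sum_mono2) auto
  also have "\<dots> = (\<Sum>j\<in>J. \<Sum>u | u \<in> F \<and> u \<in> A j. ?c j)"
    by (simp add: Int_def)
  also have "\<dots> = (\<Sum>u\<in>F. \<Sum>j | j \<in> J \<and> u \<in> A j. ?c j)"
    using assms by (intro sum.swap_restrict) auto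
  also have "\<dots> < (\<Sum>u\<in>F. 1)"
    using assms by (intro sum_strict_mono) auto
  finally show ?thesis by simp
qed

text \<open>
  The induction removes fractional coordinates, and it runs over all families \<open>J\<close> at once because
  constraints with few fractional coordinates are dropped on the way. The clause that integral
  coordinates never change is what bounds the error of a dropped constraint: from then on only its
  at most \<open>T j\<close> fractional coordinates can move, each by less than \<open>1\<close>.
\<close>

theorem weighted_Beck_Fiala_rounding:
  fixes A :: "'j \<Rightarrow> 'u set" and T :: "'j \<Rightarrow> nat" and x :: "'u \<Rightarrow> real"
  assumes "finite J" "finite U"
    and "\<And>j. j \<in> J \<Longrightarrow> A j \<subseteq> U" and "\<And>j. j \<in> J \<Longrightarrow> T j \<ge> 1"
    and "\<And>u. u \<in> U \<Longrightarrow> (\<Sum>j | j \<in> J \<and> u \<in> A j. 1 / (real (T j) + 1)) < 1"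
    and "\<And>u. u \<in> U \<Longrightarrow> 0 \<le> x u \<and> x u \<le> 1"
  shows "\<exists>y. (\<forall>u\<in>U. y u \<in> {0, 1} \<and> (x u \<in> {0, 1} \<longrightarrow> y u = x u)) \<and>
             (\<forall>j\<in>J. \<bar>(\<Sum>u\<in>A j. y u) - (\<Sum>u\<in>A j. x u)\<bar> < real (T j))"
  using assms
proof (induction "card {u \<in> U. x u \<notin> {0, 1}}" arbitrary: J x rule: less_induct)
  case less
  define F where "F = {u \<in> U. x u \<notin> {0, 1}}"
  have F: "finite F" "F \<subseteq> U" using less.prems(2) by (auto simp: F_def)
  have xF: "0 < x u \<and> x u < 1" if "u \<in> F" for u
    using that less.prems(6)[of u] by (auto simp: F_def)
  show ?case
  proof (cases "F = {}")
    case True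
    then have "\<forall>u\<in>U. x u \<in> {0, 1}" by (auto simp: F_def)
    then show ?thesis using less.prems(4) by (intro exI[of _ x]) force
  next
    case False
    define K where "K = {j \<in> J. card (F \<inter> A j) > T j}"
    have K: "K \<subseteq> J" "finite K" using less.prems(1) by (auto simp: K_def)
    have "card K < card F"
      unfolding K_def using less.prems(1,5) F False
      by (intro card_active_constraints_less) auto
    from underdetermined_system_nontrivial_solution
      [OF K(2) F(1) this, of "\<lambda>j u. of_bool (u \<in> A j) :: real"]
    obtain w where w: "\<exists>u\<in>F. w u \<noteq> 0"
      "\<And>j. j \<in> K \<Longrightarrow> (\<Sum>u\<in>F. of_bool (u \<in> A j) * w u) = (0::real)" by blast
    obtain t where t: "\<And>u. u \<in> F \<Longrightarrow> 0 \<le> x u + t * w u \<and> x u + t * w u \<le> 1"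
      "\<exists>u\<in>F. x u + t * w u \<in> {0, 1}"
      using move_to_cube_boundary[of F x w] F(1) xF w(1) by metis
    \<comment> \<open>One step: move along the kernel direction until a coordinate becomes integral.\<close>
    define z where "z u = (if u \<in> F then x u + t * w u else x u)" for u
    have z01: "0 \<le> z u \<and> z u \<le> 1" if "u \<in> U" for u
      using that t(1) less.prems(6) by (auto simp: z_def)
    have zx: "z u = x u" if "u \<in> U" "x u \<in> {0, 1}" for u
      using that by (auto simp: z_def F_def)
    have "{u \<in> U. z u \<notin> {0, 1}} \<subset> F"
    proof -
      have "{u \<in> U. z u \<notin> {0, 1}} \<subseteq> F" using zx by (auto simp: F_def)
      moreover obtain p where "p \<in> F" "z p \<in> {0, 1}" using t(2) by (auto simp: z_def)
      ultimately show ?thesis by blast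
    qed
    then have dec: "card {u \<in> U. z u \<notin> {0, 1}} < card {u \<in> U. x u \<notin> {0, 1}}"
      using F(1) unfolding F_def by (intro psubset_card_mono) auto
    have loadK: "(\<Sum>j | j \<in> K \<and> u \<in> A j. 1 / (real (T j) + 1)) < 1" if "u \<in> U" for u
    proof -
      have "(\<Sum>j | j \<in> K \<and> u \<in> A j. 1 / (real (T j) + 1))
          \<le> (\<Sum>j | j \<in> J \<and> u \<in> A j. 1 / (real (T j) + 1))"
        using K less.prems(1) by (intro sum_mono2) auto
      then show ?thesis using less.prems(5)[OF that] by linarith
    qed
    have "\<exists>y. (\<forall>u\<in>U. y u \<in> {0, 1} \<and> (z u \<in> {0, 1} \<longrightarrow> y u = z u)) \<and>
        (\<forall>j\<in>K. \<bar>(\<Sum>u\<in>A j. y u) - (\<Sum>u\<in>A j. z u)\<bar> < real (T j))"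
    proof (rule less.hyps[OF dec K(2) less.prems(2) _ _ loadK z01])
      show "A j \<subseteq> U" "1 \<le> T j" if "j \<in> K" for j
        using that K(1) less.prems(3,4) by blast+
    qed
    then obtain y where y: "\<And>u. u \<in> U \<Longrightarrow> y u \<in> {0, 1}"
      "\<And>u. u \<in> U \<Longrightarrow> z u \<in> {0, 1} \<Longrightarrow> y u = z u"
      "\<And>j. j \<in> K \<Longrightarrow> \<bar>(\<Sum>u\<in>A j. y u) - (\<Sum>u\<in>A j. z u)\<bar> < real (T j)"
      by metis
    have yx: "y u = x u" if "u \<in> U" "x u \<in> {0, 1}" for u
      using that y(2) zx by metis
    have "\<bar>(\<Sum>u\<in>A j. y u) - (\<Sum>u\<in>A j. x u)\<bar> < real (T j)" if j: "j \<in> J" for j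
    proof -
      have Aj: "finite (A j)" "A j \<subseteq> U"
        using less.prems(2,3) j by (auto intro: finite_subset)
      show ?thesis
      proof (cases "j \<in> K")
        case True
        have "(\<Sum>u\<in>A j. z u) = (\<Sum>u\<in>A j. x u + (if u \<in> F then t * w u else 0))"
          by (intro sum.cong) (auto simp: z_def)
        also have "\<dots> = (\<Sum>u\<in>A j. x u) + (\<Sum>u\<in>A j \<inter> F. t * w u)"
          using Aj by (simp add: sum.distrib sum.inter_restrict)
        also have "(\<Sum>u\<in>A j \<inter> F. t * w u) = t * (\<Sum>u\<in>F. of_bool (u \<in> A j) * w u)"
          using F(1) by (simp add: sum_distrib_left sum.inter_restrict Int_commute[of "A j"]
              of_bool_def if_distrib if_distribR cong: if_cong)
        finally show ?thesis using y(3)[OF True] w(2)[OF True] by simp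
      next
        case False
        then have le: "card (A j \<inter> F) \<le> T j" using j by (auto simp: K_def Int_commute)
        have "(\<Sum>u\<in>A j. y u) - (\<Sum>u\<in>A j. x u) = (\<Sum>u\<in>A j. y u - x u)"
          by (simp add: sum_subtractf)
        also have "\<dots> = (\<Sum>u\<in>A j \<inter> F. y u - x u)"
          using Aj yx by (intro sum.mono_neutral_right) (auto simp: F_def)
        finally have eq: "(\<Sum>u\<in>A j. y u) - (\<Sum>u\<in>A j. x u) = (\<Sum>u\<in>A j \<inter> F. y u - x u)" .
        show ?thesis
        proof (cases "A j \<inter> F = {}")
          case True
          then show ?thesis using eq less.prems(4)[OF j] by simp
        next
          case False
          have "\<bar>\<Sum>u\<in>A j \<inter> F. y u - x u\<bar> \<le> (\<Sum>u\<in>A j \<inter> F. \<bar>y u - x u\<bar>)"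
            by (rule sum_abs)
          also have "\<dots> < (\<Sum>u\<in>A j \<inter> F. 1)"
          proof (rule sum_strict_mono)
            fix u assume "u \<in> A j \<inter> F"
            then show "\<bar>y u - x u\<bar> < 1" using y(1)[of u] xF[of u] subsetD[OF F(2), of u] by auto
          qed (use False Aj in auto)
          finally show ?thesis using eq le by simp
        qed
      qed
    qed
    with y(1) yx show ?thesis by blast
  qed
qed

section \<open>Balanced colorings of set systems of bounded degree\<close>

text \<open>
  The variables are the pairs of a point and a color, all with initial value \<open>1 / k\<close>. A pair occurs
  in the constraint of its point, with threshold \<open>1\<close>, and in at most \<open>d\<close> balance constraints. So
  the rounding applies as soon as \<open>1 / 2 + d / (T + 1) < 1\<close> holds for the threshold \<open>T\<close> of
  the latter, which makes \<open>T = 2 * d\<close> the smallest choice.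
\<close>

theorem multicolor_Beck_Fiala:
  fixes B :: "'i \<Rightarrow> 'v set"
  assumes "finite V" "finite I" "d \<ge> 1" "k \<ge> 1"
    and B: "\<And>i. i \<in> I \<Longrightarrow> B i \<subseteq> V"
    and deg: "\<And>v. v \<in> V \<Longrightarrow> card {i \<in> I. v \<in> B i} \<le> d"
  obtains c where "c \<in> V \<rightarrow> {1..k}"
    and "\<And>i j. i \<in> I \<Longrightarrow> j \<in> {1..k} \<Longrightarrow>
           \<bar>real (card {v \<in> B i. c v = j}) - real (card (B i)) / real k\<bar> < 2 * real d"
proof -
  define U where "U = V \<times> {1..k}"
  define J where "J = V <+> I \<times> {1..k}"
  define A where "A = case_sum (\<lambda>v. {v} \<times> {1..k}) (\<lambda>(i, j). B i \<times> {j})"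
  define T where "T = case_sum (\<lambda>_::'v. 1) (\<lambda>_::'i \<times> nat. 2 * d)"
  have load: "(\<Sum>q | q \<in> J \<and> u \<in> A q. 1 / (real (T q) + 1)) < 1" if "u \<in> U" for u
  proof -
    obtain v j where u: "u = (v, j)" "v \<in> V" "j \<in> {1..k}" using \<open>u \<in> U\<close> by (auto simp: U_def)
    define D where "D = {i \<in> I. v \<in> B i}"
    have fD: "finite D" using assms by (simp add: D_def)
    have "{q. q \<in> J \<and> u \<in> A q} = {v} <+> (D \<times> {j})"
      using u by (auto simp: J_def A_def D_def)
    then have "(\<Sum>q | q \<in> J \<and> u \<in> A q. 1 / (real (T q) + 1))
        = 1 / 2 + (\<Sum>q\<in>D \<times> {j}. 1 / (2 * real d + 1))"
      using fD by (simp add: sum.Plus T_def)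
    also have "\<dots> = 1 / 2 + real (card D) / (2 * real d + 1)" using fD by (simp add: card_cartesian_product)
    also have "\<dots> \<le> 1 / 2 + real d / (2 * real d + 1)"
      using deg[OF u(2)] by (intro add_left_mono divide_right_mono) (auto simp: D_def)
    also have "\<dots> < 1" by (simp add: field_simps)
    finally show ?thesis .
  qed
  have "\<exists>y. (\<forall>u\<in>U. y u \<in> {0, 1} \<and> (1 / real k \<in> {0, 1} \<longrightarrow> y u = 1 / real k)) \<and>
      (\<forall>q\<in>J. \<bar>(\<Sum>u\<in>A q. y u) - (\<Sum>u\<in>A q. 1 / real k)\<bar> < real (T q))"
  proof (rule weighted_Beck_Fiala_rounding[OF _ _ _ _ load])
    show "finite J" "finite U" using assms by (auto simp: J_def U_def)
    show "A q \<subseteq> U" if "q \<in> J" for q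
      using that by (auto simp: J_def A_def U_def dest!: subsetD[OF B])
    show "1 \<le> T q" if "q \<in> J" for q using that assms by (auto simp: J_def T_def)
    show "0 \<le> 1 / real k \<and> 1 / real k \<le> 1" using assms by simp
  qed
  then obtain y where y: "\<And>u. u \<in> U \<Longrightarrow> y u = 0 \<or> y u = (1::real)"
    "\<And>q. q \<in> J \<Longrightarrow> \<bar>(\<Sum>u\<in>A q. y u) - (\<Sum>u\<in>A q. 1 / real k)\<bar> < real (T q)"
    by blast
  have y_of_bool: "y (v, j) = of_bool (y (v, j) = 1)" if "v \<in> V" "j \<in> {1..k}" for v j
    using y(1)[of "(v, j)"] that by (auto simp: U_def)
  \<comment> \<open>The number of colors of a point is an integer at distance less than \<open>1\<close> from \<open>1\<close>.\<close>
  have unique: "card {j \<in> {1..k}. y (v, j) = 1} = 1" if v: "v \<in> V" for v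
  proof -
    have "(\<Sum>u\<in>{v} \<times> {1..k}. y u) = (\<Sum>j\<in>{1..k}. y (v, j))"
      by (simp add: sum.cartesian_product')
    also have "\<dots> = (\<Sum>j\<in>{1..k}. of_bool (y (v, j) = 1))"
      using y_of_bool v by (intro sum.cong) auto
    also have "\<dots> = real (card {j \<in> {1..k}. y (v, j) = 1})"
      by (simp add: sum_of_bool_eq Int_def)
    finally have "\<bar>real (card {j \<in> {1..k}. y (v, j) = 1}) - 1\<bar> < 1"
      using y(2)[of "Inl v"] v \<open>k \<ge> 1\<close>
      by (simp add: J_def InlI A_def T_def card_cartesian_product)
    then show ?thesis by linarith
  qed
  then have "\<forall>v\<in>V. \<exists>j. {j \<in> {1..k}. y (v, j) = 1} = {j}"
    by (metis card_1_singletonE)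
  then obtain c where c: "\<And>v. v \<in> V \<Longrightarrow> {j \<in> {1..k}. y (v, j) = 1} = {c v}"
    by metis
  show ?thesis
  proof
    show "c \<in> V \<rightarrow> {1..k}" using c by blast
  next
    fix i j assume i: "i \<in> I" and j: "j \<in> {1..k}"
    have fB: "finite (B i)" using assms i by (auto intro: finite_subset)
    have "(\<Sum>u\<in>B i \<times> {j}. y u) = (\<Sum>v\<in>B i. y (v, j))"
      by (simp add: sum.cartesian_product')
    also have "\<dots> = (\<Sum>v\<in>B i. of_bool (c v = j))"
    proof (rule sum.cong)
      fix v assume "v \<in> B i"
      then have v: "v \<in> V" using B i by auto
      then have "c v = j \<longleftrightarrow> y (v, j) = 1" using set_eq_iff[THEN iffD1, OF c[OF v], rule_format, of j] j by auto
      then show "y (v, j) = of_bool (c v = j)" using y_of_bool[OF v j] by simp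
    qed simp
    also have "\<dots> = real (card {v \<in> B i. c v = j})"
      using fB by (simp add: sum_of_bool_eq Int_def)
    finally show "\<bar>real (card {v \<in> B i. c v = j}) - real (card (B i)) / real k\<bar> < 2 * real d"
      using y(2)[of "Inr (i, j)"] i j
      by (simp add: J_def InrI A_def T_def card_cartesian_product)
  qed
qed

corollary polychromatic_coloring_of_large_sets:
  fixes B :: "'i \<Rightarrow> 'v set"
  assumes "finite V" "finite I" "d \<ge> 1" "k \<ge> 1"
    and "\<And>i. i \<in> I \<Longrightarrow> B i \<subseteq> V"
    and "\<And>v. v \<in> V \<Longrightarrow> card {i \<in> I. v \<in> B i} \<le> d"
  obtains c where "c \<in> V \<rightarrow> {1..k}"
    and "\<And>i j. i \<in> I \<Longrightarrow> card (B i) \<ge> 2 * d * k \<Longrightarrow> j \<in> {1..k} \<Longrightarrow> \<exists>v\<in>B i. c v = j"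
proof -
  obtain c where c: "c \<in> V \<rightarrow> {1..k}"
    "\<And>i j. i \<in> I \<Longrightarrow> j \<in> {1..k} \<Longrightarrow>
      \<bar>real (card {v \<in> B i. c v = j}) - real (card (B i)) / real k\<bar> < 2 * real d"
    using multicolor_Beck_Fiala[OF assms] by blast
  have "\<exists>v\<in>B i. c v = j" if i: "i \<in> I" "card (B i) \<ge> 2 * d * k" and j: "j \<in> {1..k}" for i j
  proof -
    have "real (2 * d * k) \<le> real (card (B i))" using i(2) by (rule of_nat_mono)
    then have "2 * real d \<le> real (card (B i)) / real k"
      using \<open>k \<ge> 1\<close> by (simp add: field_simps)
    then have "card {v \<in> B i. c v = j} \<noteq> 0" using c(2)[OF i(1) j] by auto
    then have "{v \<in> B i. c v = j} \<noteq> {}" by (metis card.empty)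
    then show ?thesis by blast
  qed
  with c(1) show ?thesis using that by blast
qed

section \<open>Blocks and strips\<close>

definition rank_on :: "'v set \<Rightarrow> ('v \<Rightarrow> 'a::linorder) \<Rightarrow> 'v \<Rightarrow> nat" where
  "rank_on V g v = card {u \<in> V. g u < g v}"

text \<open>The last block contains fewer than \<open>s\<close> points unless \<open>s\<close> divides \<open>card V\<close>.\<close>

definition block :: "'v set \<Rightarrow> ('v \<Rightarrow> 'a::linorder) \<Rightarrow> nat \<Rightarrow> nat \<Rightarrow> 'v set" where
  "block V g s q = {v \<in> V. rank_on V g v div s = q}"

lemma rank_on_less_iff:
  assumes "finite V" "u \<in> V" "v \<in> V"
  shows "rank_on V g u < rank_on V g v \<longleftrightarrow> g u < g v"
proof
  assume "g u < g v"
  then show "rank_on V g u < rank_on V g v"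
    unfolding rank_on_def using assms by (intro psubset_card_mono) (auto intro: less_trans)
next
  assume *: "rank_on V g u < rank_on V g v"
  show "g u < g v"
  proof (rule ccontr)
    assume "\<not> g u < g v"
    then have "rank_on V g v \<le> rank_on V g u"
      unfolding rank_on_def using assms by (intro card_mono) auto
    with * show False by simp
  qed
qed

lemma bij_betw_rank_on:
  assumes "finite V" "inj_on g V"
  shows "bij_betw (rank_on V g) V {..<card V}"
proof -
  have inj: "inj_on (rank_on V g) V"
  proof (rule inj_onI)
    fix u v assume uv: "u \<in> V" "v \<in> V" "rank_on V g u = rank_on V g v"
    then have "g u = g v"
      using rank_on_less_iff[OF assms(1), of u v g] rank_on_less_iff[OF assms(1), of v u g]
      by (metis less_irrefl linorder_neqE)
    then show "u = v" using assms(2) uv by (auto dest: inj_onD)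
  qed
  have "rank_on V g v < card V" if "v \<in> V" for v
    unfolding rank_on_def using assms that by (intro psubset_card_mono) auto
  then have "rank_on V g ` V \<subseteq> {..<card V}" by auto
  then have "rank_on V g ` V = {..<card V}"
    using card_image[OF inj] by (intro card_subset_eq) auto
  with inj show ?thesis by (simp add: bij_betw_def)
qed

text \<open>
  The ranks of the points in an interval are consecutive, and among \<open>2 * s\<close> consecutive numbers
  there are the \<open>s\<close> numbers \<open>q * s, \<dots>, q * s + s - 1\<close> of a full block, for some \<open>q\<close>.
\<close>

lemma full_block_in_interval:
  fixes g :: "'v \<Rightarrow> 'a::linorder"
  assumes V: "finite V" "inj_on g V" and s: "s > 0"
    and e: "e = {v \<in> V. a \<le> g v \<and> g v \<le> b}" and large: "card e \<ge> 2 * s"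
  obtains q where "q < card V" "block V g s q \<subseteq> e" "card (block V g s q) = s"
proof -
  let ?r = "rank_on V g"
  have bij: "bij_betw ?r V {..<card V}" using bij_betw_rank_on V by blast
  have eV: "e \<subseteq> V" "finite e" using e V by auto
  have "e \<noteq> {}" using large s by auto
  then have fe: "finite (?r ` e)" "?r ` e \<noteq> {}" using eV by auto
  obtain v0 where v0: "v0 \<in> e" "?r v0 = Min (?r ` e)" using Min_in[OF fe] by (metis imageE)
  obtain v1 where v1: "v1 \<in> e" "?r v1 = Max (?r ` e)" using Max_in[OF fe] by (metis imageE)
  have "?r ` e \<subseteq> {?r v0..?r v1}" using fe v0 v1 by auto
  moreover have "card (?r ` e) = card e"
    using bij eV by (intro card_image) (auto simp: bij_betw_def intro: inj_on_subset)
  ultimately have "card e \<le> card {?r v0..?r v1}" by (metis card_mono finite_atLeastAtMost)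
  then have gap: "?r v0 + 2 * s \<le> Suc (?r v1)" using large s by auto
  have r1: "?r v1 < card V" using bij v1(1) eV by (auto simp: bij_betw_def)
  have between: "v \<in> e" if "v \<in> V" "?r v0 \<le> ?r v" "?r v \<le> ?r v1" for v
  proof -
    have "g v0 \<le> g v" "g v \<le> g v1"
      using that rank_on_less_iff[OF V(1), of v v0 g] rank_on_less_iff[OF V(1), of v1 v g] v0 v1 eV
      by (meson linorder_not_less subsetD)+
    then show ?thesis using v0 v1 that e by auto
  qed
  \<comment> \<open>The first block that starts at or after the lowest rank: a division by \<open>s\<close> rounded up.\<close>
  define q where "q = (?r v0 + s - 1) div s"
  have q: "?r v0 \<le> q * s" "q * s + s \<le> Suc (?r v1)"
  proof -
    have "(?r v0 + s - 1) mod s < s" "q * s + (?r v0 + s - 1) mod s = ?r v0 + s - 1"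
      using s by (auto simp: q_def)
    then show "?r v0 \<le> q * s" "q * s + s \<le> Suc (?r v1)" using gap s by linarith+
  qed
  have blk: "block V g s q = {v \<in> V. ?r v \<in> {q * s..<q * s + s}}"
  proof -
    have "n div s = q \<longleftrightarrow> n \<in> {q * s..<q * s + s}" for n
      using s dividend_less_div_times[of s n] by (auto simp: div_nat_eqI algebra_simps)
    then show ?thesis by (simp add: block_def)
  qed
  have sub: "block V g s q \<subseteq> e" using q between by (auto simp: blk)
  have "{q * s..<q * s + s} \<subseteq> ?r ` V" using q r1 bij by (auto simp: bij_betw_def)
  then have "?r ` block V g s q = {q * s..<q * s + s}"
    unfolding blk by blast
  moreover have "inj_on ?r (block V g s q)"
    using bij by (auto simp: bij_betw_def block_def intro: inj_on_subset)
  ultimately have "card (block V g s q) = s" using card_image[of ?r "block V g s q"] by simp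
  moreover have "q < card V"
  proof -
    have "q \<le> q * s" using s by simp
    then show ?thesis using q r1 s by linarith
  qed
  ultimately show ?thesis using sub that by blast
qed

theorem strips_always_polychromatic:
  assumes "d \<ge> 1" "k \<ge> 1"
  shows "always_polychromatic d (strips d) k (4 * d * k)"
  unfolding always_polychromatic_def
proof (intro allI impI)
  fix V assume V: "V \<subseteq> Rn d \<and> finite V \<and> general_position d V"
  define s where "s = 2 * d * k"
  have s: "s > 0" using assms by (simp add: s_def)
  define I where "I = {1..d} \<times> {..<card V}"
  define B where "B = (\<lambda>(i, q). block V (\<lambda>x. x i) s q)"
  have fin: "finite V" "finite I" using V by (auto simp: I_def)
  have sub: "B p \<subseteq> V" for p by (auto simp: B_def block_def split: prod.splits)
  have deg: "card {p \<in> I. v \<in> B p} \<le> d" if "v \<in> V" for v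
  proof -
    \<comment> \<open>In each direction, only the block that belongs to the rank of \<open>v\<close> contains \<open>v\<close>.\<close>
    have "{p \<in> I. v \<in> B p} \<subseteq> (\<lambda>i. (i, rank_on V (\<lambda>x. x i) v div s)) ` {1..d}"
      by (auto simp: I_def B_def block_def)
    then have "card {p \<in> I. v \<in> B p} \<le> card {1..d}"
      by (meson card_image_le card_mono finite_atLeastAtMost finite_imageI le_trans)
    then show ?thesis by simp
  qed
  obtain c where c: "c \<in> V \<rightarrow> {1..k}"
    "\<And>p j. p \<in> I \<Longrightarrow> card (B p) \<ge> 2 * d * k \<Longrightarrow> j \<in> {1..k} \<Longrightarrow> \<exists>v\<in>B p. c v = j"
    by (rule polychromatic_coloring_of_large_sets[OF fin assms sub deg]) (simp, rule that)
  have "\<exists>v\<in>e. c v = j"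
    if e: "e \<in> snd (range_hypergraph V (strips d) (4 * d * k))" and j: "j \<in> {1..k}" for e j
  proof -
    obtain i a b where i: "i \<in> {1..d}" and "e = V \<inter> {x \<in> Rn d. a \<le> x i \<and> x i \<le> b}"
      and m: "card e = 4 * d * k"
      using e by (auto simp: range_hypergraph_def strips_def strips_dir_def)
    then have e: "e = {x \<in> V. a \<le> x i \<and> x i \<le> b}" using V by auto
    have "inj_on (\<lambda>x. x i) V"
      using V i unfolding inj_on_def general_position_def by blast
    moreover have "card e \<ge> 2 * s" using m by (simp add: s_def)
    ultimately obtain q where "q < card V" "block V (\<lambda>x. x i) s q \<subseteq> e"
        "card (block V (\<lambda>x. x i) s q) = s"
      using full_block_in_interval[of V "\<lambda>x. x i" s e a b] V s e by blast
    then show ?thesis using c(2)[of "(i, q)" j] i j by (auto simp: I_def B_def s_def)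
  qed
  then show "\<exists>c. polychromatic_coloring k (range_hypergraph V (strips d) (4 * d * k)) c"
    using c(1) by (intro exI[of _ c]) (auto simp: polychromatic_coloring_def range_hypergraph_def)
qed

theorem corollary6:
  shows "\<exists>f :: nat \<Rightarrow> real. f \<longlonglongrightarrow> 0 \<and>
    (\<forall>d\<ge>1. \<forall>k\<ge>2.
       ereal_of_enat (poly_number d (strips d) k)
         \<le> ereal (3 * exp 1 * real d * (1 + f d) * real k))"
proof (intro exI[of _ "\<lambda>_. 0"] conjI allI impI)
  show "(\<lambda>_. 0 :: real) \<longlonglongrightarrow> 0" by simp
next
  fix d k :: nat assume "d \<ge> 1" "k \<ge> 2"
  then have "poly_number d (strips d) k \<le> enat (4 * d * k)"
    unfolding poly_number_def by (intro Inf_lower) (auto intro: strips_always_polychromatic)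
  then have "ereal_of_enat (poly_number d (strips d) k) \<le> ereal_of_enat (enat (4 * d * k))"
    by (simp only: ereal_of_enat_le_iff)
  also have "\<dots> = ereal (4 * (real d * real k))" by simp
  also have "\<dots> \<le> ereal (3 * exp 1 * real d * (1 + 0) * real k)"
  proof -
    have "4 \<le> 3 * exp (1::real)" using exp_ge_add_one_self[of 1] by simp
    then have "4 * (real d * real k) \<le> 3 * exp 1 * (real d * real k)"
      by (intro mult_right_mono) auto
    then show ?thesis by (simp add: mult.assoc)
  qed
  finally show "ereal_of_enat (poly_number d (strips d) k)
    \<le> ereal (3 * exp 1 * real d * (1 + 0) * real k)" .
qed

end
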